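(* Let $n\geq 1$ be an integer. There exists an $\mathrm{OMZD}(n)$ if and only if $n\notin\{1,3\}$.
   Context: An $n\times n$ real matrix $A$ is called orthogonal if $AA^{\mathrm{T}}=cI$ for some real constant $c>0$ (it is not required that $c=1$). An $\mathrm{OMZD}(n)$ (orthogonal matrix with zero diagonal) is an $n\times n$ real matrix that is orthogonal in this sense, whose diagonal entries are all zero and whose off-diagonal entries are all nonzero. *)

theory Defs
  imports Complex_Main "Jordan_Normal_Form.Matrix"
begin

(* "Orthogonal" up to a positive scalar: the constant c need not be 1. *)
definition scaled_orthogonal :: "nat \<Rightarrow> real mat \<Rightarrow> bool" where
  "scaled_orthogonal n A \<longleftrightarrow>
     A \<in> carrier_mat n n \<and> (\<exists>c > 0. A * transpose_mat A = c \<cdot>\<^sub>m 1\<^sub>m n)"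

definition OMZD :: "nat \<Rightarrow> real mat set" where
  "OMZD n = {A. scaled_orthogonal n A \<and> (\<forall>i < n. A $$ (i, i) = 0) \<and>
     (\<forall>i < n. \<forall>j < n. i \<noteq> j \<longrightarrow> A $$ (i, j) \<noteq> 0)}"

end

(* The off-diagonal part of two rows of a 3 x 3 matrix with zero diagonal overlaps in a single
   column, so no OMZD(3) exists. For the other orders, an OMZD(m+1) and an OMZD(n+1),
   normalised to be orthogonal matrices and written as [[A, a], [a'^T, 0]] and
   [[B, b], [b'^T, 0]], combine to the OMZD(m+n) given by [[A, a b'^T], [b a'^T, B]].
   Gluing with an OMZD(4) thus raises the order by two, and orders 2, 4 and 5
   start the induction. *)
theory Submission
  imports Defs
begin

text \<open>Entrywise form: orthogonality becomes a system of row inner products, and the zero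
  pattern a single equivalence.\<close>

lemma OMZD_iff:
  "A \<in> OMZD n \<longleftrightarrow> A \<in> carrier_mat n n \<and>
     (\<exists>c>0. \<forall>i<n. \<forall>j<n. (\<Sum>k<n. A $$ (i, k) * A $$ (j, k)) = (if i = j then c else 0)) \<and>
     (\<forall>i<n. \<forall>j<n. A $$ (i, j) = 0 \<longleftrightarrow> i = j)"
proof -
  have "A * transpose_mat A = c \<cdot>\<^sub>m 1\<^sub>m n \<longleftrightarrow>
      (\<forall>i<n. \<forall>j<n. (\<Sum>k<n. A $$ (i, k) * A $$ (j, k)) = (if i = j then c else 0))"
    if "A \<in> carrier_mat n n" for c
  proof -
    have "(A * transpose_mat A) $$ (i, j) = (\<Sum>k<n. A $$ (i, k) * A $$ (j, k))"
      if "i < n" "j < n" for i j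
      using that \<open>A \<in> carrier_mat n n\<close> by (simp add: scalar_prod_def atLeast0LessThan)
    then show ?thesis
      using \<open>A \<in> carrier_mat n n\<close> by (auto simp: mat_eq_iff)
  qed
  then show ?thesis
    unfolding OMZD_def scaled_orthogonal_def by blast
qed

lemma OMZD_mat_iff:
  "mat n n (\<lambda>(i, j). f i j) \<in> OMZD n \<longleftrightarrow>
     (\<exists>c>0. \<forall>i<n. \<forall>j<n. (\<Sum>k<n. f i k * f j k) = (if i = j then c else 0)) \<and>
     (\<forall>i<n. \<forall>j<n. f i j = 0 \<longleftrightarrow> i = j)"
  unfolding OMZD_iff by simp

lemma sum_lessThan_add:
  fixes f :: "nat \<Rightarrow> 'a::comm_monoid_add"
  shows "(\<Sum>k<m + n. f k) = (\<Sum>k<m. f k) + (\<Sum>k<n. f (m + k))"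
  by (induction n) (simp_all add: add.assoc)

lemma OMZD_glue:
  assumes "A \<in> OMZD (Suc m)" and "B \<in> OMZD (Suc n)"
  shows "\<exists>M. M \<in> OMZD (m + n)"
proof -
  from assms obtain c d where c: "c > 0" and d: "d > 0"
    and A: "\<And>i j. i \<le> m \<Longrightarrow> j \<le> m \<Longrightarrow>
      (\<Sum>k<m. A $$ (i, k) * A $$ (j, k)) + A $$ (i, m) * A $$ (j, m) = (if i = j then c else 0)"
    and B: "\<And>i j. i \<le> n \<Longrightarrow> j \<le> n \<Longrightarrow>
      (\<Sum>k<n. B $$ (i, k) * B $$ (j, k)) + B $$ (i, n) * B $$ (j, n) = (if i = j then d else 0)"
    and A0: "\<And>i j. i \<le> m \<Longrightarrow> j \<le> m \<Longrightarrow> A $$ (i, j) = 0 \<longleftrightarrow> i = j"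
    and B0: "\<And>i j. i \<le> n \<Longrightarrow> j \<le> n \<Longrightarrow> B $$ (i, j) = 0 \<longleftrightarrow> i = j"
    unfolding OMZD_iff by (auto simp: less_Suc_eq_le)
  \<comment> \<open>Instead of normalising \<open>A\<close> and \<open>B\<close>, the whole block
    matrix is scaled by \<open>sqrt (c * d)\<close>. This leaves the rank-one blocks free of square
    roots, and rows get squared norm \<open>c * d\<close>.\<close>
  define f where "f i j =
    (if i < m then if j < m then sqrt d * A $$ (i, j) else A $$ (i, m) * B $$ (n, j - m)
     else if j < m then B $$ (i - m, n) * A $$ (m, j) else sqrt c * B $$ (i - m, j - m))" for i j
  have Amm: "A $$ (m, m) = 0" and Bnn: "B $$ (n, n) = 0"
    using A0 B0 by simp_all
  \<comment> \<open>The zero corner makes column \<open>m\<close> contribute nothing to products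
    with row \<open>m\<close>, so truncating to \<open>m\<close> columns preserves them.\<close>
  have Am: "(\<Sum>k<m. A $$ (i, k) * A $$ (m, k)) = (if i = m then c else 0)" if "i \<le> m" for i
    using A[of i m] that Amm by simp
  have Bn: "(\<Sum>k<n. B $$ (i, k) * B $$ (n, k)) = (if i = n then d else 0)" if "i \<le> n" for i
    using B[of i n] that Bnn by simp
  have sqrt_cancel: "sqrt c * (sqrt c * x) = c * x" "sqrt d * (sqrt d * x) = d * x" for x
    using c d by (simp_all flip: mult.assoc)
  have top: "(\<Sum>k<m + n. f i k * f j k) = (if i = j then c * d else 0)" if "i < m" "j < m" for i j
  proof -
    \<comment> \<open>The truncated last row of \<open>B\<close> has squared norm \<open>d\<close>,
      so the rank-one block supplies exactly the column-\<open>m\<close> term missing from the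
      truncated product in \<open>A\<close>.\<close>
    have "(\<Sum>k<m + n. f i k * f j k) = d * (\<Sum>k<m. A $$ (i, k) * A $$ (j, k))
        + (\<Sum>k<n. B $$ (n, k) * B $$ (n, k)) * (A $$ (i, m) * A $$ (j, m))"
      using that by (simp add: sum_lessThan_add f_def sum_distrib_left mult_ac sqrt_cancel)
    also have "\<dots> = d * (if i = j then c else 0)"
      using A[of i j] that by (simp add: Bn flip: distrib_left)
    finally show ?thesis by simp
  qed
  have bottom: "(\<Sum>k<m + n. f (m + i) k * f (m + j) k) = (if i = j then c * d else 0)"
    if "i < n" "j < n" for i j
  proof -
    have "(\<Sum>k<m + n. f (m + i) k * f (m + j) k)
        = c * (\<Sum>k<n. B $$ (i, k) * B $$ (j, k))
        + (\<Sum>k<m. A $$ (m, k) * A $$ (m, k)) * (B $$ (i, n) * B $$ (j, n))"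
      using that by (simp add: sum_lessThan_add f_def sum_distrib_left mult_ac sqrt_cancel)
    also have "\<dots> = c * (if i = j then d else 0)"
      using B[of i j] that by (simp add: Am flip: distrib_left)
    finally show ?thesis by simp
  qed
  have cross: "(\<Sum>k<m + n. f i k * f (m + j) k) = 0" if "i < m" "j < n" for i j
  proof -
    \<comment> \<open>Both terms vanish separately: each contains the product of a row with the last
      row of the same matrix.\<close>
    have "(\<Sum>k<m + n. f i k * f (m + j) k)
        = sqrt d * B $$ (j, n) * (\<Sum>k<m. A $$ (i, k) * A $$ (m, k))
        + sqrt c * A $$ (i, m) * (\<Sum>k<n. B $$ (j, k) * B $$ (n, k))"
      using that by (simp add: sum_lessThan_add f_def sum_distrib_left mult_ac)
    then show ?thesis
      using that by (simp add: Am Bn)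
  qed
  have "(\<Sum>k<m + n. f i k * f j k) = (if i = j then c * d else 0)"
    if i: "i < m + n" and j: "j < m + n" for i j
  proof -
    consider "i < m" "j < m" | j' where "i < m" "j = m + j'" "j' < n"
      | i' where "i = m + i'" "i' < n" "j < m"
      | i' j' where "i = m + i'" "i' < n" "j = m + j'" "j' < n"
      using i j by (metis add_less_cancel_left le_Suc_ex not_le)
    then show ?thesis
    proof cases
      case 1
      then show ?thesis by (rule top)
    next
      case 2
      then show ?thesis using cross by simp
    next
      case 3
      then show ?thesis using cross[of j i'] by (simp add: mult.commute)
    next
      case 4
      then show ?thesis using bottom by simp
    qed
  qed
  \<comment> \<open>In the rank-one blocks each entry is a product of an off-diagonal entry of
    \<open>A\<close> and one of \<open>B\<close>.\<close>
  moreover have "f i j = 0 \<longleftrightarrow> i = j" if "i < m + n" "j < m + n" for i j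
    using that c d A0[of i j] A0[of i m] A0[of m j] B0[of "i - m" "j - m"]
      B0[of "i - m" n] B0[of n "j - m"]
    by (auto simp: f_def)
  moreover have "c * d > 0"
    using c d by simp
  ultimately have "mat (m + n) (m + n) (\<lambda>(i, j). f i j) \<in> OMZD (m + n)"
    unfolding OMZD_mat_iff by blast
  then show ?thesis ..
qed

lemma OMZD_2_exists: "\<exists>A. A \<in> OMZD 2"
proof -
  have "mat 2 2 (\<lambda>(i, j). [[0, 1], [1, 0]] ! i ! j) \<in> OMZD 2"
    unfolding OMZD_mat_iff
    by (intro conjI exI[of _ 1]) (auto simp: numeral_eq_Suc less_Suc_eq)
  then show ?thesis ..
qed

text \<open>The witness is a skew-symmetric conference matrix.\<close>

lemma OMZD_4_exists: "\<exists>A. A \<in> OMZD 4"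
proof -
  have "mat 4 4 (\<lambda>(i, j). [[0, 1, 1, 1], [-1, 0, 1, -1], [-1, -1, 0, 1], [-1, 1, -1, 0]] ! i ! j)
      \<in> OMZD 4"
    unfolding OMZD_mat_iff
    by (intro conjI exI[of _ 3]) (auto simp: numeral_eq_Suc less_Suc_eq)
  then show ?thesis ..
qed

(* A circulant with first row (0, a, b, c, d) has orthogonal rows iff
   ab + bc + cd = 0 and ac + bd + ad = 0; for b = d = 1 this means a = -2c and 2c^2 + 2c = 1. *)
lemma OMZD_5_exists: "\<exists>A. A \<in> OMZD 5"
proof -
  define c where "c = (sqrt 3 - 1) / 2"
  have c: "c * c = 1 / 2 - c"
    by (simp add: c_def field_simps)
  have "c \<noteq> 0"
    by (simp add: c_def)
  have "mat 5 5 (\<lambda>(i, j).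
      [[0, - 2 * c, 1, c, 1], [1, 0, - 2 * c, 1, c], [c, 1, 0, - 2 * c, 1],
       [1, c, 1, 0, - 2 * c], [- 2 * c, 1, c, 1, 0]] ! i ! j) \<in> OMZD 5"
    unfolding OMZD_mat_iff
  \<comment> \<open>The squared norm of a row is \<open>(- 2 * c)^2 + 1 + c^2 + 1\<close>.\<close>
  proof (intro conjI exI[of _ "2 + 5 * (c * c)"])
    show "0 < 2 + 5 * (c * c)"
      by (simp add: add_pos_nonneg)
  qed (use c \<open>c \<noteq> 0\<close> in \<open>auto simp: numeral_eq_Suc less_Suc_eq algebra_simps\<close>)
  then show ?thesis ..
qed

lemma OMZD_add_2:
  assumes "n \<ge> 1" and "A \<in> OMZD n"
  shows "\<exists>M. M \<in> OMZD (n + 2)"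
proof -
  obtain B where "B \<in> OMZD (Suc 3)"
    using OMZD_4_exists by (auto simp: numeral_eq_Suc)
  moreover have "A \<in> OMZD (Suc (n - 1))"
    using assms by simp
  ultimately have "\<exists>M. M \<in> OMZD (n - 1 + 3)"
    using OMZD_glue by blast
  then show ?thesis
    using assms(1) by (simp add: add.commute)
qed

lemma OMZD_exists:
  assumes "n \<ge> 1" and "n \<noteq> 1" and "n \<noteq> 3"
  shows "\<exists>A. A \<in> OMZD n"
  using assms
proof (induction n rule: less_induct)
  case (less n)
  \<comment> \<open>Order 5 needs its own example because two less is the excluded order 3; order 4
    is itself the gluing piece.\<close>
  consider "n = 2" | "n = 4" | "n = 5" | "n \<ge> 6"
    using less.prems by linarith
  then show ?case
  proof cases
    case 4
    then have "n - 2 < n" "n - 2 \<ge> 1" "n - 2 \<noteq> 1" "n - 2 \<noteq> 3"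
      by linarith+
    then obtain A where "A \<in> OMZD (n - 2)"
      using less.IH by blast
    then have "\<exists>M. M \<in> OMZD (n - 2 + 2)"
      using 4 by (intro OMZD_add_2) auto
    moreover have "n - 2 + 2 = n"
      using 4 by simp
    ultimately show ?thesis
      by metis
  qed (use OMZD_2_exists OMZD_4_exists OMZD_5_exists in simp_all)
qed

text \<open>The only row is zero, which contradicts \<open>c > 0\<close>.\<close>

lemma OMZD_1_empty: "A \<notin> OMZD 1"
  by (auto simp: OMZD_iff)

lemma OMZD_3_empty: "A \<notin> OMZD 3"
proof
  assume A: "A \<in> OMZD 3"
  then have nz: "A $$ (i, j) = 0 \<longleftrightarrow> i = j" if "i < 3" "j < 3" for i j
    using that unfolding OMZD_iff by blast
  have "(\<Sum>k<3. A $$ (0, k) * A $$ (1, k)) = 0"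
    using A unfolding OMZD_iff by force
  \<comment> \<open>Diagonal zeros remove columns 0 and 1.\<close>
  then have "A $$ (0, 2) * A $$ (1, 2) = 0"
    using nz[of 0 0] nz[of 1 1] by (simp add: numeral_eq_Suc)
  then show False
    using nz[of 0 2] nz[of 1 2] by simp
qed

theorem theorem2p3:
  fixes n :: nat
  assumes "n \<ge> 1"
  shows "(\<exists>A. A \<in> OMZD n) \<longleftrightarrow> n \<notin> {1, 3}"
  using assms OMZD_exists[of n] OMZD_1_empty OMZD_3_empty by auto

end
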